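(* Let $G$ be a finite graph, $Q\ge 1$ an integer, $\hbar>0$ and $t\in\mathbb{R}$. Let $\mathcal{H}$ be the complex Hilbert space with orthonormal basis $\{|\sigma\rangle\}$ indexed by the assignments $\sigma$ of an element of $\{1,\dots,Q\}$ to each node of $G$. Let $U(t)$ be the linear operator on $\mathcal{H}$ given by $U(t)|\sigma\rangle=e^{(it/\hbar)E(\sigma)}|\sigma\rangle$, and let $|\psi\rangle=\sum_\sigma|\sigma\rangle$. Then $U(t)$ is unitary and $$\langle\psi|U(t)|\psi\rangle=\sum_\sigma e^{(it/\hbar)E(\sigma)}=A_G(Q,t).$$ That is, the Potts partition function $\sum_\sigma e^{K E(\sigma)}$ evaluated at the purely imaginary value $K=it/\hbar$ is the quantum mechanical amplitude for the state $|\psi\rangle$ to evolve to the state $U(t)|\psi\rangle$.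
   Context: $E(\sigma)$ denotes the number of edges of $G$ whose end-nodes receive the same assignment from $\sigma$ (the energy of the state $\sigma$ in the Potts model). $A_G(Q,t)=\sum_\sigma e^{(it/\hbar)E(\sigma)}$ is the quantum Potts amplitude, obtained from the Potts partition function $\sum_\sigma e^{K E(\sigma)}$ by the substitution $K=it/\hbar$. "Amplitude" refers to the number $\langle\psi|U(t)|\psi\rangle$, with $|\psi\rangle$ not normalized. *)

theory Defs
  imports "HOL-Analysis.Analysis"
begin

text \<open>
  Finite undirected graphs. Multiple edges and loops are allowed; a loop is an edge whose
  set of end-nodes is a singleton. Simple graphs are the special case in which \<open>ends\<close> is
  injective on the edges and every set of end-nodes has two elements.
\<close>

record ('v, 'e) multigraph =
  nodes :: "'v set"
  edges :: "'e set"
  ends :: "'e \<Rightarrow> 'v set"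

definition finite_graph :: "('v, 'e) multigraph \<Rightarrow> bool" where
  "finite_graph G \<longleftrightarrow> finite (nodes G) \<and> finite (edges G) \<and>
     (\<forall>e\<in>edges G. ends G e \<subseteq> nodes G \<and> (card (ends G e) = 1 \<or> card (ends G e) = 2))"

text \<open>
  Extensional functions (with value \<open>undefined\<close> off the node set), so that distinct elements
  are distinct assignments on the nodes.
\<close>

definition potts_states :: "('v, 'e) multigraph \<Rightarrow> nat \<Rightarrow> ('v \<Rightarrow> nat) set" where
  "potts_states G Q = nodes G \<rightarrow>\<^sub>E {1..Q}"

definition energy :: "('v, 'e) multigraph \<Rightarrow> ('v \<Rightarrow> nat) \<Rightarrow> nat" where
  "energy G \<sigma> = card {e \<in> edges G. \<forall>u\<in>ends G e. \<forall>v\<in>ends G e. \<sigma> u = \<sigma> v}"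

definition potts_partition :: "('v, 'e) multigraph \<Rightarrow> nat \<Rightarrow> complex \<Rightarrow> complex" where
  "potts_partition G Q K = (\<Sum>\<sigma>\<in>potts_states G Q. exp (K * of_nat (energy G \<sigma>)))"

definition quantum_potts_amplitude ::
    "('v, 'e) multigraph \<Rightarrow> real \<Rightarrow> nat \<Rightarrow> real \<Rightarrow> complex" where
  "quantum_potts_amplitude G hbar Q t =
     (\<Sum>\<sigma>\<in>potts_states G Q. exp ((\<i> * of_real t / of_real hbar) * of_nat (energy G \<sigma>)))"

text \<open>
  Complex Hilbert spaces on a type, with explicit scalar multiplication and inner product.
  The inner product is linear in its second argument (bra-ket convention).
\<close>

definition ip_norm :: "('h \<Rightarrow> 'h \<Rightarrow> complex) \<Rightarrow> 'h \<Rightarrow> real" where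
  "ip_norm ip x = sqrt (Re (ip x x))"

locale complex_hilbert_space = vector_space cscale
  for cscale :: "complex \<Rightarrow> 'h::ab_group_add \<Rightarrow> 'h" +
  fixes ip :: "'h \<Rightarrow> 'h \<Rightarrow> complex"
  assumes ip_commute: "ip x y = cnj (ip y x)"
    and ip_add_right: "ip x (y + z) = ip x y + ip x z"
    and ip_scale_right: "ip x (cscale c y) = c * ip x y"
    and ip_pos: "x \<noteq> 0 \<Longrightarrow> 0 < Re (ip x x)"
    and ip_complete:
      "(\<And>e. 0 < e \<Longrightarrow> \<exists>N. \<forall>m\<ge>N. \<forall>n\<ge>N. ip_norm ip (X m - X n) < e)
         \<Longrightarrow> \<exists>l. (\<lambda>n. ip_norm ip (X n - l)) \<longlonglongrightarrow> 0"

text \<open>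
  For a finite index set (the only case used below) an orthonormal family is a Hilbert basis
  iff it spans algebraically.
\<close>

definition orthonormal_basis ::
    "(complex \<Rightarrow> 'h::ab_group_add \<Rightarrow> 'h) \<Rightarrow> ('h \<Rightarrow> 'h \<Rightarrow> complex) \<Rightarrow> 'i set \<Rightarrow> ('i \<Rightarrow> 'h) \<Rightarrow> bool" where
  "orthonormal_basis cscale ip I ket \<longleftrightarrow>
     (\<forall>i\<in>I. \<forall>j\<in>I. ip (ket i) (ket j) = (if i = j then 1 else 0)) \<and>
     module.span cscale (ket ` I) = UNIV"

definition unitary ::
    "(complex \<Rightarrow> 'h::ab_group_add \<Rightarrow> 'h) \<Rightarrow> ('h \<Rightarrow> 'h \<Rightarrow> complex) \<Rightarrow> ('h \<Rightarrow> 'h) \<Rightarrow> bool" where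
  "unitary cscale ip U \<longleftrightarrow>
     Vector_Spaces.linear cscale cscale U \<and> bij U \<and> (\<forall>x y. ip (U x) (U y) = ip x y)"

text \<open>Existence and uniqueness are shown in \<open>ex1_potts_evolution\<close> below.\<close>

definition potts_evolution ::
    "(complex \<Rightarrow> 'h::ab_group_add \<Rightarrow> 'h) \<Rightarrow> (('v \<Rightarrow> nat) \<Rightarrow> 'h) \<Rightarrow>
     ('v, 'e) multigraph \<Rightarrow> real \<Rightarrow> nat \<Rightarrow> real \<Rightarrow> 'h \<Rightarrow> 'h" where
  "potts_evolution cscale ket G hbar Q t =
     (THE U. Vector_Spaces.linear cscale cscale U \<and>
        (\<forall>\<sigma>\<in>potts_states G Q. U (ket \<sigma>) =
           cscale (exp ((\<i> * of_real t / of_real hbar) * of_nat (energy G \<sigma>))) (ket \<sigma>)))"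

definition potts_psi ::
    "(('v \<Rightarrow> nat) \<Rightarrow> 'h::ab_group_add) \<Rightarrow> ('v, 'e) multigraph \<Rightarrow> nat \<Rightarrow> 'h" where
  "potts_psi ket G Q = (\<Sum>\<sigma>\<in>potts_states G Q. ket \<sigma>)"

lemma finite_potts_states: "finite_graph G \<Longrightarrow> finite (potts_states G Q)"
  by (auto simp: finite_graph_def potts_states_def intro: finite_PiE)

lemma ex1_linear_on_orthonormal_basis:
  assumes "complex_hilbert_space cscale ip" "finite I" "orthonormal_basis cscale ip I ket"
  shows "\<exists>!U. Vector_Spaces.linear cscale cscale U \<and> (\<forall>i\<in>I. U (ket i) = cscale (c i) (ket i))"
proof -
  interpret complex_hilbert_space cscale ip by fact
  interpret vp: vector_space_pair cscale cscale ..
  have on: "ip (ket i) (ket j) = (if i = j then 1 else 0)" if "i \<in> I" "j \<in> I" for i j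
    using assms(3) that by (auto simp: orthonormal_basis_def)
  have sp: "span (ket ` I) = UNIV"
    using assms(3) by (auto simp: orthonormal_basis_def)
  define U where "U = (\<lambda>x. \<Sum>i\<in>I. cscale (c i * ip (ket i) x) (ket i))"
  have "Vector_Spaces.linear cscale cscale U"
    unfolding U_def Vector_Spaces.linear_iff
    by (simp add: vector_space_axioms ip_add_right ip_scale_right distrib_left scale_left_distrib
          sum.distrib scale_sum_right mult.left_commute mult.assoc)
  moreover have "U (ket j) = cscale (c j) (ket j)" if "j \<in> I" for j
  proof -
    have "U (ket j) = (\<Sum>i\<in>I. if i = j then cscale (c j) (ket j) else 0)"
      unfolding U_def using that by (intro sum.cong) (auto simp: on)
    thus ?thesis using that assms(2) by simp
  qed
  moreover have "f = g"
    if "Vector_Spaces.linear cscale cscale f" "Vector_Spaces.linear cscale cscale g"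
      "\<forall>i\<in>I. f (ket i) = cscale (c i) (ket i)" "\<forall>i\<in>I. g (ket i) = cscale (c i) (ket i)" for f g
  proof
    fix x
    show "f x = g x"
      by (rule vp.linear_eq_on_span[of f g "ket ` I" x]) (use that sp in auto)
  qed
  ultimately show ?thesis by blast
qed

lemma ex1_potts_evolution:
  assumes "finite_graph G" "complex_hilbert_space cscale ip"
    and "orthonormal_basis cscale ip (potts_states G Q) ket"
  shows "\<exists>!U. Vector_Spaces.linear cscale cscale U \<and>
        (\<forall>\<sigma>\<in>potts_states G Q. U (ket \<sigma>) =
           cscale (exp ((\<i> * of_real t / of_real hbar) * of_nat (energy G \<sigma>))) (ket \<sigma>))"
  using assms by (intro ex1_linear_on_orthonormal_basis finite_potts_states)

text \<open>
  Spaces with an orthonormal basis indexed by any given finite nonempty set exist.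
\<close>

definition vec_ip :: "complex ^ 'n \<Rightarrow> complex ^ 'n \<Rightarrow> complex" where
  "vec_ip x y = (\<Sum>i\<in>UNIV. cnj (x $ i) * y $ i)"

lemma ip_norm_vec_ip: "ip_norm vec_ip x = norm (x :: complex ^ 'n)"
proof -
  have "Re (vec_ip x x) = (\<Sum>i\<in>UNIV. (norm (x $ i))\<^sup>2)"
    unfolding vec_ip_def Re_sum
    by (intro sum.cong) (auto simp: cmod_power2 simp flip: power2_eq_square)
  thus ?thesis by (simp add: ip_norm_def norm_vec_def L2_set_def)
qed

lemma complex_hilbert_space_vec: "complex_hilbert_space (*s) (vec_ip :: complex ^ 'n \<Rightarrow> _)"
proof
  fix x y z :: "complex ^ 'n" and c :: complex and X :: "nat \<Rightarrow> complex ^ 'n"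
  show "vec_ip x y = cnj (vec_ip y x)" by (simp add: vec_ip_def mult.commute)
  show "vec_ip x (y + z) = vec_ip x y + vec_ip x z"
    by (simp add: vec_ip_def distrib_left sum.distrib)
  show "vec_ip x (c *s y) = c * vec_ip x y"
    by (simp add: vec_ip_def sum_distrib_left mult.left_commute)
  show "0 < Re (vec_ip x x)" if "x \<noteq> 0"
    using ip_norm_vec_ip[of x] that by (simp add: ip_norm_def) (metis norm_eq_zero norm_ge_zero order_le_less real_sqrt_gt_0_iff)
  show "\<exists>l. (\<lambda>n. ip_norm vec_ip (X n - l)) \<longlonglongrightarrow> 0"
    if "\<And>e. 0 < e \<Longrightarrow> \<exists>N. \<forall>m\<ge>N. \<forall>n\<ge>N. ip_norm vec_ip (X m - X n) < e"
  proof -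
    have "Cauchy X" using that by (intro CauchyI) (simp add: ip_norm_vec_ip)
    then obtain l where "X \<longlonglongrightarrow> l" using Cauchy_convergent convergent_def by blast
    hence "(\<lambda>n. ip_norm vec_ip (X n - l)) \<longlonglongrightarrow> 0"
      unfolding ip_norm_vec_ip using LIM_zero tendsto_norm_zero by blast
    thus ?thesis ..
  qed
qed

lemma orthonormal_basis_vec:
  assumes "bij_betw f I (UNIV :: 'n set)"
  shows "orthonormal_basis (*s) (vec_ip :: complex ^ 'n \<Rightarrow> _) I (\<lambda>i. axis (f i) 1)"
  unfolding orthonormal_basis_def
proof
  show "\<forall>i\<in>I. \<forall>j\<in>I. vec_ip (axis (f i) 1 :: complex ^ 'n) (axis (f j) 1) = (if i = j then 1 else 0)"
    using bij_betw_imp_inj_on[OF assms]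
    by (auto simp: vec_ip_def axis_def inj_on_eq_iff if_distrib[of cnj] if_distrib[of "\<lambda>z. z * _"]
        intro!: sum.neutral cong: if_cong)
  have "(\<lambda>i. axis (f i) 1 :: complex ^ 'n) ` I = cart_basis"
    using bij_betw_imp_surj_on[OF assms] image_image[of "\<lambda>i. axis i 1 :: complex ^ 'n" f I]
    by (simp add: cart_basis_def full_SetCompr_eq)
  thus "vec.span ((\<lambda>i. axis (f i) 1 :: complex ^ 'n) ` I) = UNIV"
    by (simp add: span_cart_basis)
qed

end

theory Submission
  imports Defs
begin

text \<open>
  In the basis of kets the evolution operator is diagonal, and its diagonal entries
  \<open>exp (\<i> t E(\<sigma>) / \<hbar>)\<close> have modulus one because \<open>t\<close>, \<open>\<hbar>\<close> and the energies are real.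
  Everything follows from reading vectors through their coordinates \<open>\<langle>i|x\<rangle>\<close>: in a finite
  orthonormal basis a vector is the sum of its coordinates times the basis vectors
  (\<open>expansion\<close>), so inner products are computed coordinatewise (\<open>parseval\<close>) and the operator
  multiplies the coordinate at \<open>i\<close> by the eigenvalue \<open>c i\<close> (\<open>coord_diagonal\<close>). Multiplication
  of coordinates by phases is invertible and preserves the Parseval sum, which gives unitarity
  (\<open>unitary_diagonal\<close>). The vector \<open>\<psi>\<close> has all coordinates equal to one, so its matrix element
  is the trace of the diagonal operator, the sum of its eigenvalues
  (\<open>matrix_element_diagonal\<close>), and this sum is the partition function at \<open>K = \<i> t / \<hbar>\<close>.
\<close>

locale finite_orthonormal_basis = complex_hilbert_space cscale ip
  for cscale :: "complex \<Rightarrow> 'h::ab_group_add \<Rightarrow> 'h" and ip :: "'h \<Rightarrow> 'h \<Rightarrow> complex" +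
  fixes I :: "'i set" and ket :: "'i \<Rightarrow> 'h"
  assumes finite_index: "finite I"
    and basis: "orthonormal_basis cscale ip I ket"
begin

lemma ip_ket: "i \<in> I \<Longrightarrow> j \<in> I \<Longrightarrow> ip (ket i) (ket j) = (if i = j then 1 else 0)"
  using basis by (auto simp: orthonormal_basis_def)

lemma span_ket: "span (ket ` I) = UNIV"
  using basis by (auto simp: orthonormal_basis_def)

lemma ip_zero_right: "ip x 0 = 0"
  using ip_add_right[of x 0 0] by simp

lemma ip_sum_right: "ip x (\<Sum>i\<in>A. f i) = (\<Sum>i\<in>A. ip x (f i))"
  by (induction A rule: infinite_finite_induct) (auto simp: ip_zero_right ip_add_right)

lemma ip_sum_left: "ip (\<Sum>i\<in>A. f i) y = (\<Sum>i\<in>A. ip (f i) y)"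
proof -
  have "ip (\<Sum>i\<in>A. f i) y = (\<Sum>i\<in>A. cnj (ip y (f i)))"
    by (subst ip_commute) (simp add: ip_sum_right)
  thus ?thesis by (metis (no_types, lifting) ip_commute sum.cong)
qed

lemma ip_scale_left: "ip (cscale a x) y = cnj a * ip x y"
  by (metis complex_cnj_mult ip_commute ip_scale_right)

text \<open>
  The expansion is linear in \<open>x\<close> and fixes each ket by orthonormality; the kets span.
\<close>

lemma expansion: "x = (\<Sum>i\<in>I. cscale (ip (ket i) x) (ket i))"
proof -
  interpret vp: vector_space_pair cscale cscale ..
  define P where "P = (\<lambda>x. \<Sum>i\<in>I. cscale (ip (ket i) x) (ket i))"
  have "Vector_Spaces.linear cscale cscale P"
    unfolding P_def Vector_Spaces.linear_iff
    by (simp add: vector_space_axioms ip_add_right ip_scale_right scale_left_distrib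
          sum.distrib scale_sum_right)
  moreover have "P (ket j) = ket j" if "j \<in> I" for j
  proof -
    have "P (ket j) = (\<Sum>i\<in>I. if i = j then ket j else 0)"
      unfolding P_def using that by (intro sum.cong) (auto simp: ip_ket)
    thus ?thesis using that finite_index by simp
  qed
  ultimately have "id x = P x"
    by (intro vp.linear_eq_on_span[of id P "ket ` I" x]) (auto simp: span_ket linear_id)
  thus ?thesis by (simp add: P_def)
qed

lemma coords_eqI:
  assumes "\<And>i. i \<in> I \<Longrightarrow> ip (ket i) x = ip (ket i) y"
  shows "x = y"
proof -
  have "(\<Sum>i\<in>I. cscale (ip (ket i) x) (ket i)) = (\<Sum>i\<in>I. cscale (ip (ket i) y) (ket i))"
    using assms by (intro sum.cong) simp_all
  thus ?thesis by (simp flip: expansion)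
qed

lemma coord_sum:
  assumes "i \<in> I"
  shows "ip (ket i) (\<Sum>j\<in>I. cscale (a j) (ket j)) = a i"
proof -
  have "ip (ket i) (\<Sum>j\<in>I. cscale (a j) (ket j)) = (\<Sum>j\<in>I. if i = j then a j else 0)"
    unfolding ip_sum_right using assms by (intro sum.cong) (auto simp: ip_scale_right ip_ket)
  thus ?thesis using assms finite_index by simp
qed

lemma parseval: "ip x y = (\<Sum>i\<in>I. cnj (ip (ket i) x) * ip (ket i) y)"
proof -
  have "ip x y = ip (\<Sum>i\<in>I. cscale (ip (ket i) x) (ket i)) y"
    by (simp flip: expansion)
  thus ?thesis by (simp add: ip_sum_left ip_scale_left)
qed

context
  fixes U :: "'h \<Rightarrow> 'h" and c :: "'i \<Rightarrow> complex"
  assumes linear_U: "Vector_Spaces.linear cscale cscale U"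
    and U_ket: "\<And>i. i \<in> I \<Longrightarrow> U (ket i) = cscale (c i) (ket i)"
begin

lemma coord_diagonal:
  assumes "i \<in> I"
  shows "ip (ket i) (U x) = c i * ip (ket i) x"
proof -
  interpret U: Vector_Spaces.linear cscale cscale U by (fact linear_U)
  have "U x = U (\<Sum>j\<in>I. cscale (ip (ket j) x) (ket j))"
    by (simp flip: expansion)
  also have "\<dots> = (\<Sum>j\<in>I. cscale (c j * ip (ket j) x) (ket j))"
    by (simp add: U.sum U.scale U_ket mult.commute)
  finally show ?thesis using assms by (simp add: coord_sum)
qed

lemma unitary_diagonal:
  assumes phase: "\<And>i. i \<in> I \<Longrightarrow> cmod (c i) = 1"
  shows "unitary cscale ip U"
proof -
  have cancel: "cnj (c i) * c i = 1" if "i \<in> I" for i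
    using phase[OF that] complex_norm_square[of "c i"] by (simp add: mult.commute)
  have "ip (U x) (U y) = ip x y" for x y
  proof -
    have "ip (U x) (U y) = (\<Sum>i\<in>I. cnj (ip (ket i) (U x)) * ip (ket i) (U y))"
      by (fact parseval)
    also have "\<dots> = (\<Sum>i\<in>I. (cnj (c i) * c i) * (cnj (ip (ket i) x) * ip (ket i) y))"
      by (intro sum.cong) (simp_all add: coord_diagonal mult_ac)
    also have "\<dots> = (\<Sum>i\<in>I. cnj (ip (ket i) x) * ip (ket i) y)"
      by (intro sum.cong) (simp_all add: cancel)
    finally show ?thesis by (simp only: parseval[of x y])
  qed
  moreover have "inj U"
  proof (intro injI coords_eqI)
    fix x y i
    assume "U x = U y" and i: "i \<in> I"
    hence "c i * ip (ket i) x = c i * ip (ket i) y"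
      by (metis coord_diagonal)
    thus "ip (ket i) x = ip (ket i) y"
      using cancel[OF i] by auto
  qed
  moreover have "surj U"
  proof (rule surjI)
    \<comment> \<open>The preimage multiplies each coordinate by the conjugate, hence inverse, phase.\<close>
    fix y
    show "U (\<Sum>i\<in>I. cscale (cnj (c i) * ip (ket i) y) (ket i)) = y"
    proof (rule coords_eqI)
      fix i
      assume i: "i \<in> I"
      have "ip (ket i) (U (\<Sum>i\<in>I. cscale (cnj (c i) * ip (ket i) y) (ket i))) =
          (cnj (c i) * c i) * ip (ket i) y"
        using i by (simp only: coord_diagonal coord_sum mult_ac)
      thus "ip (ket i) (U (\<Sum>i\<in>I. cscale (cnj (c i) * ip (ket i) y) (ket i))) = ip (ket i) y"
        using cancel[OF i] by simp
    qed
  qed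
  ultimately show ?thesis
    by (simp add: unitary_def linear_U bij_def)
qed

lemma matrix_element_diagonal: "ip (\<Sum>i\<in>I. ket i) (U (\<Sum>i\<in>I. ket i)) = (\<Sum>i\<in>I. c i)"
proof -
  have one: "ip (ket i) (\<Sum>j\<in>I. ket j) = 1" if "i \<in> I" for i
    using coord_sum[OF that, of "\<lambda>_. 1"] by simp
  show ?thesis
    by (simp add: ip_sum_left coord_diagonal one)
qed

end

end

theorem mainTheorem5:
  fixes G :: "('v, 'e) multigraph" and Q :: nat and hbar t :: real
    and cscale :: "complex \<Rightarrow> 'h::ab_group_add \<Rightarrow> 'h"
    and ip :: "'h \<Rightarrow> 'h \<Rightarrow> complex"
    and ket :: "('v \<Rightarrow> nat) \<Rightarrow> 'h"
  assumes "finite_graph G" and "Q \<ge> 1" and "hbar > 0"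
    and "complex_hilbert_space cscale ip"
    and "orthonormal_basis cscale ip (potts_states G Q) ket"
  shows "unitary cscale ip (potts_evolution cscale ket G hbar Q t) \<and>
    ip (potts_psi ket G Q) (potts_evolution cscale ket G hbar Q t (potts_psi ket G Q)) =
      (\<Sum>\<sigma>\<in>potts_states G Q.
         exp ((\<i> * of_real t / of_real hbar) * of_nat (energy G \<sigma>))) \<and>
    (\<Sum>\<sigma>\<in>potts_states G Q.
         exp ((\<i> * of_real t / of_real hbar) * of_nat (energy G \<sigma>))) =
      quantum_potts_amplitude G hbar Q t \<and>
    potts_partition G Q (\<i> * of_real t / of_real hbar) =
      ip (potts_psi ket G Q) (potts_evolution cscale ket G hbar Q t (potts_psi ket G Q))"
proof -
  interpret finite_orthonormal_basis cscale ip "potts_states G Q" ket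
    using assms
    by (simp add: finite_orthonormal_basis_def finite_orthonormal_basis_axioms_def
          finite_potts_states)
  define c where "c = (\<lambda>\<sigma>. exp ((\<i> * of_real t / of_real hbar) * of_nat (energy G \<sigma>)))"
  define U where "U = potts_evolution cscale ket G hbar Q t"
  have "Vector_Spaces.linear cscale cscale U \<and>
      (\<forall>\<sigma>\<in>potts_states G Q. U (ket \<sigma>) = cscale (c \<sigma>) (ket \<sigma>))"
    unfolding U_def c_def potts_evolution_def
    by (rule theI'[OF ex1_potts_evolution[OF assms(1,4,5)]])
  hence lin: "Vector_Spaces.linear cscale cscale U"
    and eig: "\<And>\<sigma>. \<sigma> \<in> potts_states G Q \<Longrightarrow> U (ket \<sigma>) = cscale (c \<sigma>) (ket \<sigma>)"
    by auto
  have "cmod (c \<sigma>) = 1" for \<sigma>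
    by (simp add: c_def)
  hence unit: "unitary cscale ip U"
    by (intro unitary_diagonal[OF lin eig])
  have amp: "ip (potts_psi ket G Q) (U (potts_psi ket G Q)) = (\<Sum>\<sigma>\<in>potts_states G Q. c \<sigma>)"
    unfolding potts_psi_def by (rule matrix_element_diagonal[OF lin eig])
  show ?thesis
    using unit amp
    by (simp add: U_def c_def quantum_potts_amplitude_def potts_partition_def)
qed

end
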